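(* Let $W$ be a bounded operator on $\mathcal H$. For every partition $\kappa=\{X_1,\dots,X_K\}$ of $\mathcal X$, $$\|W\|_\mu^2=\sum_{k=1}^K\|W\pi_{X_k}\|_\mu^2 .$$
   Context: $(\mathcal X,\mathcal B,\mu)$ is a probability measure space and $\mathcal H=L^2(\mathcal X,\mu)$ (complex-valued). For $X\in\mathcal B$, $\pi_X:\mathcal H\to\mathcal H$ is the orthogonal projector $\pi_Xf=\mathbf 1_X f$. A partition is a finite family $\chi=\{Y_1,\dots,Y_J\}\subset\mathcal B$ with $\mu(\mathcal X\setminus\bigcup_j Y_j)=0$ and $\mu(Y_j\cap Y_k)=0$ for $j\ne k$. For a bounded operator $W$ on $\mathcal H$ with operator norm $\|W\|$, put $\mathcal M_\chi(W)=\sum_{j=1}^J\mu(Y_j)\|W\pi_{Y_j}\|^2$, and define the $\mu$-norm $\|W\|_\mu=\inf_\chi\sqrt{\mathcal M_\chi(W)}$, the infimum being over all partitions $\chi$. *)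

theory Defs
  imports "HOL-Probability.Probability"
begin

text \<open>
  The Hilbert space \<open>L\<^sup>2(M)\<close> is represented by its square-integrable functions, with equality
  of vectors being equality almost everywhere.
\<close>

definition L2 :: "'a measure \<Rightarrow> ('a \<Rightarrow> complex) set" where
  "L2 M = {f \<in> borel_measurable M. integrable M (\<lambda>x. (cmod (f x))\<^sup>2)}"

definition L2_nrm :: "'a measure \<Rightarrow> ('a \<Rightarrow> complex) \<Rightarrow> real" where
  "L2_nrm M f = sqrt (\<integral>x. (cmod (f x))\<^sup>2 \<partial>M)"

text \<open>
  An operator on \<open>L\<^sup>2(M)\<close> is a map on representatives that respects equality almost everywhere;
  linearity is likewise required almost everywhere. Its values outside \<open>L2 M\<close> are irrelevant.
\<close>

definition L2_bounded_operator :: "'a measure \<Rightarrow> (('a \<Rightarrow> complex) \<Rightarrow> ('a \<Rightarrow> complex)) \<Rightarrow> bool" where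
  "L2_bounded_operator M W \<longleftrightarrow>
     (\<forall>f\<in>L2 M. W f \<in> L2 M) \<and>
     (\<forall>f\<in>L2 M. \<forall>g\<in>L2 M. (AE x in M. f x = g x) \<longrightarrow> (AE x in M. W f x = W g x)) \<and>
     (\<forall>f\<in>L2 M. \<forall>g\<in>L2 M. AE x in M. W (\<lambda>y. f y + g y) x = W f x + W g x) \<and>
     (\<forall>c. \<forall>f\<in>L2 M. AE x in M. W (\<lambda>y. c * f y) x = c * W f x) \<and>
     (\<exists>C. \<forall>f\<in>L2 M. L2_nrm M (W f) \<le> C * L2_nrm M f)"

text \<open>
  Operator norm, in the form of \<^const>\<open>onorm\<close>. Vectors of norm \<open>0\<close> contribute the value \<open>0\<close>.
\<close>

definition L2_onorm :: "'a measure \<Rightarrow> (('a \<Rightarrow> complex) \<Rightarrow> ('a \<Rightarrow> complex)) \<Rightarrow> real" where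
  "L2_onorm M W = (SUP f\<in>L2 M. L2_nrm M (W f) / L2_nrm M f)"

definition proj :: "'a set \<Rightarrow> ('a \<Rightarrow> complex) \<Rightarrow> ('a \<Rightarrow> complex)" where
  "proj X f = (\<lambda>x. indicator X x * f x)"

text \<open>
  A partition is the finite family \<open>Y 1, \<dots>, Y J\<close>; it covers the space, and its members are
  disjoint, only up to null sets.
\<close>

definition ae_partition :: "'a measure \<Rightarrow> nat \<Rightarrow> (nat \<Rightarrow> 'a set) \<Rightarrow> bool" where
  "ae_partition M J Y \<longleftrightarrow>
     (\<forall>j\<in>{1..J}. Y j \<in> sets M) \<and>
     emeasure M (space M - (\<Union>j\<in>{1..J}. Y j)) = 0 \<and>
     (\<forall>j\<in>{1..J}. \<forall>k\<in>{1..J}. j \<noteq> k \<longrightarrow> emeasure M (Y j \<inter> Y k) = 0)"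

definition partition_sum ::
  "'a measure \<Rightarrow> nat \<Rightarrow> (nat \<Rightarrow> 'a set) \<Rightarrow> (('a \<Rightarrow> complex) \<Rightarrow> ('a \<Rightarrow> complex)) \<Rightarrow> real" where
  "partition_sum M J Y W = (\<Sum>j=1..J. measure M (Y j) * (L2_onorm M (W \<circ> proj (Y j)))\<^sup>2)"

definition mu_nrm :: "'a measure \<Rightarrow> (('a \<Rightarrow> complex) \<Rightarrow> ('a \<Rightarrow> complex)) \<Rightarrow> real" where
  "mu_nrm M W = Inf {sqrt (partition_sum M J Y W) | J Y. ae_partition M J Y}"

end

theory Submission
  imports Defs
begin

text \<open>
  Both inequalities come from common refinements. Restricting a partition \<open>Y\<close> to \<open>X k\<close> gives a
  competitor for \<open>W \<circ> proj (X k)\<close>, and additivity of the measure together with monotonicity of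
  \<open>A \<mapsto> \<parallel>W \<pi>\<^sub>A\<parallel>\<close> bounds the total cost of these competitors by that of \<open>Y\<close>. Conversely,
  near-optimal partitions for the operators \<open>W \<circ> proj (X k)\<close>, each cut down to \<open>X k\<close>, together
  form a partition for \<open>W\<close> that costs no more.
\<close>

section \<open>Partitions up to null sets and their refinements\<close>

text \<open>An arbitrary index set allows a refinement to be indexed by pairs; renumbering to
  \<open>{1..J}\<close> is then done only once, in \<open>mu_nrm_power2_le\<close>.\<close>

definition ae_partition_on :: "'a measure \<Rightarrow> 'i set \<Rightarrow> ('i \<Rightarrow> 'a set) \<Rightarrow> bool" where
  "ae_partition_on M I Y \<longleftrightarrow>
     (\<forall>i\<in>I. Y i \<in> sets M) \<and>
     (AE x in M. \<exists>i\<in>I. x \<in> Y i) \<and>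
     (\<forall>i\<in>I. \<forall>j\<in>I. i \<noteq> j \<longrightarrow> Y i \<inter> Y j \<in> null_sets M)"

lemma ae_partition_iff: "ae_partition M J Y \<longleftrightarrow> ae_partition_on M {1..J} Y"
\<comment> \<open>\<open>emeasure\<close> is 0 by default on non-measurable sets, so measure zero
  means being a null set only once the members are known to be measurable.\<close>
proof (cases "\<forall>j\<in>{1..J}. Y j \<in> sets M")
  case True
  then have "space M - (\<Union>j\<in>{1..J}. Y j) \<in> sets M"
    by (intro sets.Diff sets.top sets.finite_UN) auto
  moreover have "{x \<in> space M. \<not> (\<exists>i\<in>{1..J}. x \<in> Y i)} = space M - (\<Union>j\<in>{1..J}. Y j)"
    by auto
  ultimately have "emeasure M (space M - (\<Union>j\<in>{1..J}. Y j)) = 0 \<longleftrightarrow> (AE x in M. \<exists>i\<in>{1..J}. x \<in> Y i)"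
    by (subst AE_iff_measurable) auto
  with True show ?thesis
    unfolding ae_partition_def ae_partition_on_def null_sets_def by auto
next
  case False
  then show ?thesis
    unfolding ae_partition_def ae_partition_on_def by blast
qed

text \<open>Each cell \<open>Y i\<close> is cut by its own partition \<open>Z i\<close>. Two
  distinct pieces overlap inside \<open>Y i \<inter> Y j\<close> if they come from different cells,
  and inside \<open>Z i l \<inter> Z i m\<close> otherwise. Finiteness of \<open>I\<close> merges
  the covering statements for the \<open>Z i\<close> into a single almost-everywhere
  statement.\<close>

lemma ae_partition_on_refine:
  assumes Y: "ae_partition_on M I Y" and Z: "\<And>i. i \<in> I \<Longrightarrow> ae_partition_on M (L i) (Z i)"
    and "finite I"
  shows "ae_partition_on M (Sigma I L) (\<lambda>(i, l). Y i \<inter> Z i l)"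
  unfolding ae_partition_on_def
proof (intro conjI ballI impI)
  have sets: "Y i \<in> sets M" "Z i l \<in> sets M" if "i \<in> I" "l \<in> L i" for i l
    using Y Z that by (auto simp: ae_partition_on_def)
  show "(case p of (i, l) \<Rightarrow> Y i \<inter> Z i l) \<in> sets M" if "p \<in> Sigma I L" for p
    using that sets by auto
  have "AE x in M. \<exists>i\<in>I. x \<in> Y i"
    using Y by (simp add: ae_partition_on_def)
  moreover have "AE x in M. \<forall>i\<in>I. \<exists>l\<in>L i. x \<in> Z i l"
    using Z \<open>finite I\<close> by (simp add: AE_finite_all ae_partition_on_def)
  ultimately show "AE x in M. \<exists>p\<in>Sigma I L. x \<in> (case p of (i, l) \<Rightarrow> Y i \<inter> Z i l)"
    by eventually_elim fastforce
  fix p q assume p: "p \<in> Sigma I L" and q: "q \<in> Sigma I L" and "p \<noteq> q"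
  obtain i l j m where pq: "p = (i, l)" "q = (j, m)"
    by fastforce
  have meas: "(Y i \<inter> Z i l) \<inter> (Y j \<inter> Z j m) \<in> sets M"
    using p q pq sets by auto
  show "(case p of (i, l) \<Rightarrow> Y i \<inter> Z i l) \<inter> (case q of (i, l) \<Rightarrow> Y i \<inter> Z i l) \<in> null_sets M"
  proof (cases "i = j")
    case True
    then have "Z i l \<inter> Z j m \<in> null_sets M"
      using Z[of i] p q pq \<open>p \<noteq> q\<close> by (auto simp: ae_partition_on_def)
    then show ?thesis
      using meas pq by (auto intro: null_sets_subset)
  next
    case False
    then have "Y i \<inter> Y j \<in> null_sets M"
      using Y p q pq by (auto simp: ae_partition_on_def)
    then show ?thesis
      using meas pq by (auto intro: null_sets_subset)
  qed
qed

text \<open>Finite additivity tolerates null overlaps, and \<open>A\<close> differs from the union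
  of its pieces by a null set.\<close>

lemma (in finite_measure) sum_measure_Int_ae_partition_on:
  assumes X: "ae_partition_on M I X" and "finite I" and A: "A \<in> sets M"
  shows "(\<Sum>i\<in>I. measure M (A \<inter> X i)) = measure M A"
proof -
  have sets: "A \<inter> X i \<in> sets M" if "i \<in> I" for i
    using X A that by (auto simp: ae_partition_on_def)
  have "measure M A = measure M (\<Union>i\<in>I. A \<inter> X i)"
  proof (rule finite_measure_eq_AE)
    have "AE x in M. \<exists>i\<in>I. x \<in> X i"
      using X by (simp add: ae_partition_on_def)
    then show "AE x in M. x \<in> A \<longleftrightarrow> x \<in> (\<Union>i\<in>I. A \<inter> X i)"
      by eventually_elim auto
    show "(\<Union>i\<in>I. A \<inter> X i) \<in> sets M"
      using sets \<open>finite I\<close> by blast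
  qed (rule A)
  also have "\<dots> = (\<Sum>i\<in>I. measure M (A \<inter> X i))"
  proof (rule measure_UNION_AE)
    show "pairwise (\<lambda>i j. AE x in M. x \<notin> A \<inter> X i \<or> x \<notin> A \<inter> X j) I"
    proof (rule pairwiseI)
      fix i j assume "i \<in> I" "j \<in> I" "i \<noteq> j"
      then have "X i \<inter> X j \<in> null_sets M"
        using X by (simp add: ae_partition_on_def)
      then show "AE x in M. x \<notin> A \<inter> X i \<or> x \<notin> A \<inter> X j"
        by (rule AE_I') auto
    qed
  qed (use sets \<open>finite I\<close> in \<open>auto simp: fmeasurable_eq_sets\<close>)
  finally show ?thesis ..
qed

section \<open>Projections and the operator norm\<close>

lemma zero_in_L2: "(\<lambda>_. 0) \<in> L2 M"
  by (simp add: L2_def)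

lemma L2_nrm_nonneg: "0 \<le> L2_nrm M f"
  by (simp add: L2_nrm_def)

lemma cmod_proj_power2: "(cmod (proj A f x))\<^sup>2 = indicator A x * (cmod (f x))\<^sup>2"
  by (simp add: proj_def indicator_def)

lemma proj_in_L2:
  assumes "f \<in> L2 M" and "A \<in> sets M"
  shows "proj A f \<in> L2 M"
proof -
  have "integrable M (\<lambda>x. indicator A x * (cmod (f x))\<^sup>2)"
    using assms integrable_mult_indicator[of A M "\<lambda>x. (cmod (f x))\<^sup>2"] by (simp add: L2_def)
  moreover have "proj A f \<in> borel_measurable M"
    using assms unfolding proj_def L2_def
    by (intro borel_measurable_times borel_measurable_indicator) auto
  ultimately show ?thesis
    by (simp add: L2_def cmod_proj_power2)
qed

lemma L2_nrm_proj_le: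
  assumes "f \<in> L2 M" and "A \<in> sets M"
  shows "L2_nrm M (proj A f) \<le> L2_nrm M f"
  unfolding L2_nrm_def
proof (intro real_sqrt_le_mono integral_mono)
  show "integrable M (\<lambda>x. (cmod (proj A f x))\<^sup>2)" "integrable M (\<lambda>x. (cmod (f x))\<^sup>2)"
    using proj_in_L2[OF assms] assms(1) by (simp_all add: L2_def)
qed (simp add: cmod_proj_power2 indicator_def)

text \<open>An identity of functions, not merely almost everywhere, so composed operators can be
  rewritten without appeal to \<open>W\<close>.\<close>

lemma proj_comp: "proj A \<circ> proj B = proj (A \<inter> B)"
  by (auto simp: proj_def fun_eq_iff indicator_def)

text \<open>Boundedness in isolation: it passes to \<open>W \<circ> proj A\<close>, and it makes the
  supremum in \<open>L2_onorm\<close> one over a set bounded above.\<close>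

definition L2_bdd :: "'a measure \<Rightarrow> (('a \<Rightarrow> complex) \<Rightarrow> ('a \<Rightarrow> complex)) \<Rightarrow> bool" where
  "L2_bdd M W \<longleftrightarrow> (\<exists>C. \<forall>f\<in>L2 M. L2_nrm M (W f) \<le> C * L2_nrm M f)"

lemma L2_bddE:
  assumes "L2_bdd M W"
  obtains C where "0 \<le> C" "\<And>f. f \<in> L2 M \<Longrightarrow> L2_nrm M (W f) \<le> C * L2_nrm M f"
proof -
  obtain C where C: "\<And>f. f \<in> L2 M \<Longrightarrow> L2_nrm M (W f) \<le> C * L2_nrm M f"
    using assms by (auto simp: L2_bdd_def)
  show thesis
  proof (rule that[of "max C 0"])
    fix f assume "f \<in> L2 M"
    then show "L2_nrm M (W f) \<le> max C 0 * L2_nrm M f"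
      using C[of f] mult_right_mono[OF max.cobounded1[of C 0] L2_nrm_nonneg[of M f]] by linarith
  qed simp
qed

lemma L2_bdd_proj:
  assumes "L2_bdd M W" and A: "A \<in> sets M"
  shows "L2_bdd M (W \<circ> proj A)"
proof -
  obtain C where C: "0 \<le> C" "\<And>f. f \<in> L2 M \<Longrightarrow> L2_nrm M (W f) \<le> C * L2_nrm M f"
    using assms(1) by (rule L2_bddE) blast
  have "L2_nrm M ((W \<circ> proj A) f) \<le> C * L2_nrm M f" if "f \<in> L2 M" for f
    using C(2)[OF proj_in_L2[OF that A]] mult_left_mono[OF L2_nrm_proj_le[OF that A] C(1)] by simp
  then show ?thesis
    by (auto simp: L2_bdd_def)
qed

lemma bdd_above_L2_onorm:
  assumes "L2_bdd M W"
  shows "bdd_above ((\<lambda>f. L2_nrm M (W f) / L2_nrm M f) ` L2 M)"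
proof -
  obtain C where C: "0 \<le> C" "\<And>f. f \<in> L2 M \<Longrightarrow> L2_nrm M (W f) \<le> C * L2_nrm M f"
    using assms by (rule L2_bddE) blast
  \<comment> \<open>For a vector of norm 0 the quotient is 0 by the convention on division, which is
    where \<open>0 \<le> C\<close> enters.\<close>
  have "L2_nrm M (W f) / L2_nrm M f \<le> C" if "f \<in> L2 M" for f
    using C(2)[OF that] C(1) L2_nrm_nonneg[of M f]
    by (cases "L2_nrm M f = 0") (auto simp: pos_divide_le_eq order.strict_iff_order)
  then show ?thesis
    by (auto simp: bdd_above_def)
qed

lemma L2_nrm_le_L2_onorm:
  assumes "L2_bdd M W" and f: "f \<in> L2 M"
  shows "L2_nrm M (W f) \<le> L2_onorm M W * L2_nrm M f"
proof (cases "L2_nrm M f = 0")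
  \<comment> \<open>The quotient carries no information here; boundedness itself forces
    \<open>W f\<close> to have norm 0.\<close>
  case True
  then show ?thesis
    using assms by (force simp: L2_bdd_def)
next
  case False
  then have "0 < L2_nrm M f"
    using L2_nrm_nonneg[of M f] by simp
  moreover have "L2_nrm M (W f) / L2_nrm M f \<le> L2_onorm M W"
    unfolding L2_onorm_def using f bdd_above_L2_onorm[OF assms(1)] by (rule cSUP_upper)
  ultimately show ?thesis
    by (simp add: pos_divide_le_eq)
qed

lemma L2_onorm_nonneg:
  assumes "L2_bdd M W"
  shows "0 \<le> L2_onorm M W"
  unfolding L2_onorm_def
  by (rule cSUP_upper2[OF bdd_above_L2_onorm[OF assms] zero_in_L2]) (simp add: L2_nrm_nonneg)

lemma L2_onorm_le:
  assumes "0 \<le> C" and C: "\<And>f. f \<in> L2 M \<Longrightarrow> L2_nrm M (W f) \<le> C * L2_nrm M f"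
  shows "L2_onorm M W \<le> C"
  unfolding L2_onorm_def
proof (rule cSUP_least)
  show "L2 M \<noteq> {}"
    using zero_in_L2 by blast
  show "L2_nrm M (W f) / L2_nrm M f \<le> C" if "f \<in> L2 M" for f
    using C[OF that] assms(1) L2_nrm_nonneg[of M f]
    by (cases "L2_nrm M f = 0") (auto simp: pos_divide_le_eq order.strict_iff_order)
qed

lemma L2_onorm_proj_le:
  assumes W: "L2_bdd M W" and A: "A \<in> sets M"
  shows "L2_onorm M (W \<circ> proj A) \<le> L2_onorm M W"
proof (rule L2_onorm_le[OF L2_onorm_nonneg[OF W]])
  fix f assume f: "f \<in> L2 M"
  show "L2_nrm M ((W \<circ> proj A) f) \<le> L2_onorm M W * L2_nrm M f"
    using L2_nrm_le_L2_onorm[OF W proj_in_L2[OF f A]]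
      mult_left_mono[OF L2_nrm_proj_le[OF f A] L2_onorm_nonneg[OF W]] by simp
qed

text \<open>\<open>proj A\<close> factors through \<open>proj B\<close>, and precomposing with a
  projection, a contraction, cannot raise the operator norm.\<close>

lemma L2_onorm_proj_mono:
  assumes "L2_bdd M W" and "A \<in> sets M" "B \<in> sets M" "A \<subseteq> B"
  shows "L2_onorm M (W \<circ> proj A) \<le> L2_onorm M (W \<circ> proj B)"
proof -
  have "W \<circ> proj A = (W \<circ> proj B) \<circ> proj A"
    using \<open>A \<subseteq> B\<close> by (simp add: comp_assoc proj_comp Int_absorb1)
  then show ?thesis
    using L2_onorm_proj_le[OF L2_bdd_proj] assms by metis
qed

text \<open>\<open>proj {} f\<close> is the zero function, whose image has norm 0 by boundedness.
  This removes the pieces lying outside \<open>A\<close> in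
  \<open>mu_nrm_proj_power2_le\<close>.\<close>

lemma L2_onorm_proj_empty:
  assumes "L2_bdd M W"
  shows "L2_onorm M (W \<circ> proj {}) = 0"
proof (rule antisym)
  have "L2_nrm M (W (proj {} f)) \<le> 0" for f
    using L2_nrm_le_L2_onorm[OF assms zero_in_L2[of M]] by (simp add: proj_def L2_nrm_def)
  then show "L2_onorm M (W \<circ> proj {}) \<le> 0"
    by (intro L2_onorm_le) auto
  show "0 \<le> L2_onorm M (W \<circ> proj {})"
    by (intro L2_onorm_nonneg L2_bdd_proj assms) simp
qed

section \<open>Competitors and near-optimal partitions for the \<open>mu_nrm\<close> infimum\<close>

lemma partition_sum_nonneg: "0 \<le> partition_sum M J Y W"
  by (simp add: partition_sum_def sum_nonneg)

text \<open>Guarantees that the infimum in \<open>mu_nrm\<close> is over a nonempty set.\<close>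

lemma ae_partition_space: "ae_partition M 1 (\<lambda>_. space M)"
  by (simp add: ae_partition_def)

lemma mu_nrm_nonneg: "0 \<le> mu_nrm M W"
  unfolding mu_nrm_def
  by (rule cInf_greatest) (use ae_partition_space partition_sum_nonneg in force)+

lemma mu_nrm_power2_le:
  assumes Y: "ae_partition_on M I Y" and "finite I"
  shows "(mu_nrm M W)\<^sup>2 \<le> (\<Sum>i\<in>I. measure M (Y i) * (L2_onorm M (W \<circ> proj (Y i)))\<^sup>2)"
proof -
  obtain h where h: "bij_betw h {1..card I} I"
    using ex_bij_betw_nat_finite_1[OF \<open>finite I\<close>] by blast
  have im: "h ` {1..card I} = I" and inj: "inj_on h {1..card I}"
    using h by (auto simp: bij_betw_def)
  have "ae_partition M (card I) (Y \<circ> h)"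
    unfolding ae_partition_iff ae_partition_on_def
  proof (intro conjI ballI impI)
    have "AE x in M. \<exists>i\<in>h ` {1..card I}. x \<in> Y i"
      using Y im by (simp add: ae_partition_on_def)
    then show "AE x in M. \<exists>i\<in>{1..card I}. x \<in> (Y \<circ> h) i"
      by eventually_elim auto
  next
    fix i j assume "i \<in> {1..card I}" "j \<in> {1..card I}" "i \<noteq> j"
    then have "h i \<in> I" "h j \<in> I" "h i \<noteq> h j"
      using im inj by (auto dest: inj_onD)
    then show "(Y \<circ> h) i \<inter> (Y \<circ> h) j \<in> null_sets M"
      using Y by (simp add: ae_partition_on_def)
  next
    fix i assume "i \<in> {1..card I}"
    then have "h i \<in> I"
      using im by blast
    then show "(Y \<circ> h) i \<in> sets M"
      using Y by (simp add: ae_partition_on_def)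
  qed
  then have "mu_nrm M W \<le> sqrt (partition_sum M (card I) (Y \<circ> h) W)"
    unfolding mu_nrm_def using partition_sum_nonneg
    by (intro cInf_lower) (auto intro!: bdd_belowI[of _ 0])
  then have "(mu_nrm M W)\<^sup>2 \<le> (sqrt (partition_sum M (card I) (Y \<circ> h) W))\<^sup>2"
    using mu_nrm_nonneg by (rule power_mono)
  also have "\<dots> = partition_sum M (card I) (Y \<circ> h) W"
    by (simp add: partition_sum_nonneg)
  also have "\<dots> = (\<Sum>i\<in>I. measure M (Y i) * (L2_onorm M (W \<circ> proj (Y i)))\<^sup>2)"
    using sum.reindex_bij_betw[OF h, of "\<lambda>i. measure M (Y i) * (L2_onorm M (W \<circ> proj (Y i)))\<^sup>2"]
    by (simp add: partition_sum_def)
  finally show ?thesis .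
qed

text \<open>The error is added to the square, so that errors for several operators simply add
  up.\<close>

lemma ex_partition_sum_less:
  assumes "0 < e"
  obtains J Y where "ae_partition M J Y" "partition_sum M J Y W < (mu_nrm M W)\<^sup>2 + e"
proof -
  have "mu_nrm M W < sqrt ((mu_nrm M W)\<^sup>2 + e)"
    using assms by (intro real_less_rsqrt) simp
  then have "Inf {sqrt (partition_sum M J Y W) | J Y. ae_partition M J Y}
      < sqrt ((mu_nrm M W)\<^sup>2 + e)"
    by (simp only: mu_nrm_def)
  moreover have "{sqrt (partition_sum M J Y W) | J Y. ae_partition M J Y} \<noteq> {}"
    using ae_partition_space by blast
  ultimately have "\<exists>r\<in>{sqrt (partition_sum M J Y W) | J Y. ae_partition M J Y}.
      r < sqrt ((mu_nrm M W)\<^sup>2 + e)"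
    by (rule cInf_lessD[rotated])
  then obtain J Y where "ae_partition M J Y"
    "sqrt (partition_sum M J Y W) < sqrt ((mu_nrm M W)\<^sup>2 + e)"
    by blast
  then show thesis
    by (intro that) auto
qed

section \<open>The two inequalities\<close>

context prob_space
begin

text \<open>A competitor must cover the whole space, so each \<open>Y i\<close> is split into its
  parts inside and outside \<open>A\<close>. The operator \<open>W \<circ> proj A\<close> vanishes
  on the outer parts, and on the inner ones its norm is at most that of
  \<open>W \<circ> proj (Y i)\<close>.\<close>

lemma mu_nrm_proj_power2_le:
  assumes W: "L2_bdd M W" and Y: "ae_partition_on M I Y" and "finite I" and A: "A \<in> sets M"
  shows "(mu_nrm M (W \<circ> proj A))\<^sup>2
    \<le> (\<Sum>i\<in>I. measure M (Y i \<inter> A) * (L2_onorm M (W \<circ> proj (Y i)))\<^sup>2)"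
proof -
  define Z where "Z = (\<lambda>b. if b then A else space M - A)"
  have "ae_partition_on M UNIV Z"
    unfolding ae_partition_on_def
  proof (intro conjI ballI impI)
    show "AE x in M. \<exists>b\<in>UNIV. x \<in> Z b"
      by (rule AE_I2) (auto simp: Z_def UNIV_bool)
  qed (use A in \<open>auto simp: Z_def Int_commute\<close>)
  then have "ae_partition_on M (I \<times> UNIV) (\<lambda>(i, b). Y i \<inter> Z b)"
    using ae_partition_on_refine[OF Y, of "\<lambda>_. UNIV" "\<lambda>_. Z"] \<open>finite I\<close> by simp
  then have "(mu_nrm M (W \<circ> proj A))\<^sup>2 \<le> (\<Sum>(i, b)\<in>I \<times> UNIV.
      measure M (Y i \<inter> Z b) * (L2_onorm M (W \<circ> proj (A \<inter> (Y i \<inter> Z b))))\<^sup>2)"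
    using mu_nrm_power2_le[of M "I \<times> UNIV" "\<lambda>(i, b). Y i \<inter> Z b" "W \<circ> proj A"] \<open>finite I\<close>
    by (simp add: comp_assoc proj_comp case_prod_unfold)
  also have "\<dots> = (\<Sum>i\<in>I. \<Sum>b\<in>UNIV.
      measure M (Y i \<inter> Z b) * (L2_onorm M (W \<circ> proj (A \<inter> (Y i \<inter> Z b))))\<^sup>2)"
    by (simp add: sum.cartesian_product)
  also have "\<dots> \<le> (\<Sum>i\<in>I. measure M (Y i \<inter> A) * (L2_onorm M (W \<circ> proj (Y i)))\<^sup>2)"
  proof (rule sum_mono)
    fix i assume "i \<in> I"
    then have Yi: "Y i \<in> sets M"
      using Y by (simp add: ae_partition_on_def)
    have "A \<inter> (Y i \<inter> Z False) = {}" "A \<inter> (Y i \<inter> Z True) = A \<inter> Y i" "Y i \<inter> Z True = Y i \<inter> A"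
      by (auto simp: Z_def)
    then have "(\<Sum>b\<in>UNIV. measure M (Y i \<inter> Z b) * (L2_onorm M (W \<circ> proj (A \<inter> (Y i \<inter> Z b))))\<^sup>2)
        = measure M (Y i \<inter> A) * (L2_onorm M (W \<circ> proj (A \<inter> Y i)))\<^sup>2"
      by (simp add: UNIV_bool L2_onorm_proj_empty[OF W])
    also have "\<dots> \<le> measure M (Y i \<inter> A) * (L2_onorm M (W \<circ> proj (Y i)))\<^sup>2"
      using A Yi by (intro mult_left_mono power_mono L2_onorm_proj_mono L2_onorm_nonneg
          L2_bdd_proj W) auto
    finally show "(\<Sum>b\<in>UNIV. measure M (Y i \<inter> Z b) *
        (L2_onorm M (W \<circ> proj (A \<inter> (Y i \<inter> Z b))))\<^sup>2)
        \<le> measure M (Y i \<inter> A) * (L2_onorm M (W \<circ> proj (Y i)))\<^sup>2" .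
  qed
  finally show ?thesis .
qed

lemma sum_mu_nrm_proj_power2_le:
  assumes W: "L2_bdd M W" and X: "ae_partition_on M I X" and "finite I"
  shows "(\<Sum>k\<in>I. (mu_nrm M (W \<circ> proj (X k)))\<^sup>2) \<le> (mu_nrm M W)\<^sup>2"
proof (rule field_le_epsilon)
  fix e :: real assume "0 < e"
  then obtain J Y where Y: "ae_partition M J Y"
    and less: "partition_sum M J Y W < (mu_nrm M W)\<^sup>2 + e"
    by (rule ex_partition_sum_less)
  have "(\<Sum>k\<in>I. (mu_nrm M (W \<circ> proj (X k)))\<^sup>2)
      \<le> (\<Sum>k\<in>I. \<Sum>j=1..J. measure M (Y j \<inter> X k) * (L2_onorm M (W \<circ> proj (Y j)))\<^sup>2)"
    using X Y by (intro sum_mono mu_nrm_proj_power2_le W)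
      (auto simp: ae_partition_iff ae_partition_on_def)
  \<comment> \<open>The norm factor no longer depends on \<open>k\<close>, so for each
    \<open>j\<close> the weights can be added up over \<open>k\<close> to
    \<open>measure M (Y j)\<close>.\<close>
  also have "\<dots> = (\<Sum>j=1..J. (\<Sum>k\<in>I. measure M (Y j \<inter> X k)) * (L2_onorm M (W \<circ> proj (Y j)))\<^sup>2)"
    by (subst sum.swap) (simp add: sum_distrib_right)
  also have "\<dots> = partition_sum M J Y W"
    unfolding partition_sum_def using X Y \<open>finite I\<close>
    by (intro sum.cong refl) (simp add: sum_measure_Int_ae_partition_on ae_partition_def)
  finally show "(\<Sum>k\<in>I. (mu_nrm M (W \<circ> proj (X k)))\<^sup>2) \<le> (mu_nrm M W)\<^sup>2 + e"
    using less by linarith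
qed

lemma mu_nrm_power2_le_sum_proj:
  assumes W: "L2_bdd M W" and X: "ae_partition_on M I X" and "finite I"
  shows "(mu_nrm M W)\<^sup>2 \<le> (\<Sum>k\<in>I. (mu_nrm M (W \<circ> proj (X k)))\<^sup>2)"
proof (rule field_le_epsilon)
  fix e :: real assume "0 < e"
  \<comment> \<open>\<open>card I\<close> errors of size \<open>d\<close> total at most
    \<open>e\<close>; the added 1 keeps the denominator positive for every \<open>I\<close>.\<close>
  define d where "d = e / (real (card I) + 1)"
  have "0 < d"
    using \<open>0 < e\<close> by (simp add: d_def)
  have "\<exists>J Y. ae_partition M J Y \<and>
      partition_sum M J Y (W \<circ> proj (X k)) < (mu_nrm M (W \<circ> proj (X k)))\<^sup>2 + d" for k
    using ex_partition_sum_less[OF \<open>0 < d\<close>] by metis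
  then obtain J Y where Y: "\<And>k. ae_partition M (J k) (Y k)"
    and less: "\<And>k. partition_sum M (J k) (Y k) (W \<circ> proj (X k))
      < (mu_nrm M (W \<circ> proj (X k)))\<^sup>2 + d"
    by metis
  \<comment> \<open>The near-optimal partitions may have different lengths, hence the dependent
    index set.\<close>
  have "ae_partition_on M (SIGMA k:I. {1..J k}) (\<lambda>(k, j). X k \<inter> Y k j)"
    using Y by (intro ae_partition_on_refine X \<open>finite I\<close>) (simp add: ae_partition_iff)
  then have "(mu_nrm M W)\<^sup>2 \<le> (\<Sum>(k, j)\<in>(SIGMA k:I. {1..J k}).
      measure M (X k \<inter> Y k j) * (L2_onorm M (W \<circ> proj (X k \<inter> Y k j)))\<^sup>2)"
    using mu_nrm_power2_le[of M "SIGMA k:I. {1..J k}" "\<lambda>(k, j). X k \<inter> Y k j" W] \<open>finite I\<close>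
    by (simp add: case_prod_unfold)
  also have "\<dots> = (\<Sum>k\<in>I. \<Sum>j=1..J k.
      measure M (X k \<inter> Y k j) * (L2_onorm M (W \<circ> proj (X k \<inter> Y k j)))\<^sup>2)"
    using \<open>finite I\<close> by (simp add: sum.Sigma)
  \<comment> \<open>By \<open>proj_comp\<close> the norm factors on both sides coincide; only the
    measure grows, from that of \<open>X k \<inter> Y k j\<close> to that of
    \<open>Y k j\<close>.\<close>
  also have "\<dots> \<le> (\<Sum>k\<in>I. partition_sum M (J k) (Y k) (W \<circ> proj (X k)))"
    unfolding partition_sum_def comp_assoc proj_comp
    using X Y by (intro sum_mono mult_right_mono finite_measure_mono) (auto simp: ae_partition_def)
  also have "\<dots> \<le> (\<Sum>k\<in>I. (mu_nrm M (W \<circ> proj (X k)))\<^sup>2 + d)"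
    by (intro sum_mono less_imp_le less)
  also have "\<dots> = (\<Sum>k\<in>I. (mu_nrm M (W \<circ> proj (X k)))\<^sup>2) + real (card I) * d"
    by (simp add: sum.distrib)
  also have "real (card I) * d \<le> e"
    using \<open>0 < e\<close> by (simp add: d_def field_simps)
  finally show "(mu_nrm M W)\<^sup>2 \<le> (\<Sum>k\<in>I. (mu_nrm M (W \<circ> proj (X k)))\<^sup>2) + e"
    by (simp only: add_left_mono)
qed

end

theorem lemma4p1:
  fixes M :: "'a measure"
    and W :: "('a \<Rightarrow> complex) \<Rightarrow> ('a \<Rightarrow> complex)"
    and K :: nat
    and X :: "nat \<Rightarrow> 'a set"
  assumes "prob_space M"
    and "L2_bounded_operator M W"
    and "ae_partition M K X"
  shows "(mu_nrm M W)\<^sup>2 = (\<Sum>k=1..K. (mu_nrm M (W \<circ> proj (X k)))\<^sup>2)"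
proof -
  interpret prob_space M by fact
  have "L2_bdd M W"
    using assms(2) by (simp add: L2_bounded_operator_def L2_bdd_def)
  moreover have "ae_partition_on M {1..K} X"
    using assms(3) by (simp add: ae_partition_iff)
  ultimately show ?thesis
    by (intro antisym mu_nrm_power2_le_sum_proj sum_mu_nrm_proj_power2_le) auto
qed

end
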